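(* Let $X\in\mathbb R^{n\times q}$ be a known matrix of rank $q<n$, and consider the model $Y\sim N_{n\times p}(XB^T,\Sigma\otimes\Psi)$ with unknown $B\in\mathbb R^{p\times q}$, $\Sigma\in\mathcal S_p^+$, $\Psi\in\mathcal S_n^+$. Let $\mathcal G$ be the group of transformations on $\mathbb R^{n\times p}$ of the form $g(Y) = XC^T+YA^T$ with $C\in\mathbb R^{p\times q}$ and nonsingular $A\in\mathbb R^{p\times p}$. If $n\le p+q$, then any $\mathcal G$-invariant function of $Y$ is constant almost everywhere (with respect to Lebesgue measure on $\mathbb R^{n\times p}$), and as a result, any $\mathcal G$-invariant level-$\alpha$ test $\phi$ of $H:\Psi=I_n$ versus $K:\Psi\neq I_n$ has power $\mathrm E[\phi(Y)\mid B,\Sigma\otimes\Psi]=\alpha$ for all $B\in\mathbb R^{p\times q}$, $\Sigma\in\mathcal S_p^+$ and $\Psi\in\mathcal S_n^+$.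
   Context: $\mathcal S_k^+$ is the set of $k\times k$ nonsingular covariance (symmetric positive definite) matrices. $Y\sim N_{n\times p}(M,\Sigma\otimes\Psi)$ (matrix normal) means $Y$ has the distribution of $M+\Psi^{1/2}Z\Sigma^{1/2}$, where $Z$ is an $n\times p$ matrix of i.i.d. standard normal entries and square roots are symmetric; thus $\Psi$ is the row covariance and $\Sigma$ the column covariance. $\mathrm E[\,\cdot\mid B,\Sigma\otimes\Psi]$ is expectation under $Y\sim N_{n\times p}(XB^T,\Sigma\otimes\Psi)$. A function $f$ on $\mathbb R^{n\times p}$ is $\mathcal G$-invariant if $f(g(Y))=f(Y)$ for all $g\in\mathcal G$ and all $Y$. A (possibly randomized) test is a measurable function $\phi:\mathbb R^{n\times p}\to[0,1]$. The expectation of a $\mathcal G$-invariant test under $H$ does not depend on $B$ or $\Sigma$, and such a test is called level-$\alpha$ if $\mathrm E[\phi(Y)\mid B,\Sigma\otimes I_n]=\alpha$. *)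

theory Defs
  imports "HOL-Probability.Probability"
begin

definition spd :: "real^'k^'k \<Rightarrow> bool"
  where "spd S \<longleftrightarrow> transpose S = S \<and> (\<forall>x. x \<noteq> 0 \<longrightarrow> x \<bullet> (S *v x) > 0)"

(* A positive definite S has several symmetric square roots (sign choices on the
   eigenspaces) but exactly one positive definite one; the value is only meaningful for spd S. *)
definition msqrt :: "real^'k^'k \<Rightarrow> real^'k^'k"
  where "msqrt S = (THE R. spd R \<and> R ** R = S)"

definition std_normal_matrix :: "(real^'p^'n) measure"
  where "std_normal_matrix =
    distr (\<Pi>\<^sub>M ij\<in>(UNIV :: ('n \<times> 'p) set). std_normal_distribution) borel
      (\<lambda>z. \<chi> i j. z (i, j))"

(* The arguments are the mean, the column covariance and the row covariance, in this order:
   N(M, \<Sigma> \<otimes> \<Psi>). A matrix with n rows and p columns has type real^'p^'n. *)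
definition matrix_normal ::
    "real^'p^'n \<Rightarrow> real^'p^'p \<Rightarrow> real^'n^'n \<Rightarrow> (real^'p^'n) measure"
  where "matrix_normal M \<Sigma> \<Psi> =
    distr std_normal_matrix borel (\<lambda>Z. M + msqrt \<Psi> ** Z ** msqrt \<Sigma>)"

definition transformations :: "real^'q^'n \<Rightarrow> (real^'p^'n \<Rightarrow> real^'p^'n) set"
  where "transformations X =
    {g. \<exists>(C :: real^'q^'p) (A :: real^'p^'p).
          invertible A \<and> g = (\<lambda>Y. X ** transpose C + Y ** transpose A)}"

definition invariant_under :: "('a \<Rightarrow> 'a) set \<Rightarrow> ('a \<Rightarrow> 'b) \<Rightarrow> bool"
  where "invariant_under G f \<longleftrightarrow> (\<forall>g\<in>G. \<forall>y. f (g y) = f y)"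

definition randomized_test :: "(real^'p^'n \<Rightarrow> real) \<Rightarrow> bool"
  where "randomized_test \<phi> \<longleftrightarrow> \<phi> \<in> borel_measurable borel \<and> (\<forall>Y. 0 \<le> \<phi> Y \<and> \<phi> Y \<le> 1)"

definition test_power ::
    "real^'q^'n \<Rightarrow> (real^'p^'n \<Rightarrow> real) \<Rightarrow> real^'q^'p \<Rightarrow> real^'p^'p \<Rightarrow> real^'n^'n \<Rightarrow> real"
  where "test_power X \<phi> B \<Sigma> \<Psi> = (\<integral>Y. \<phi> Y \<partial>matrix_normal (X ** transpose B) \<Sigma> \<Psi>)"

definition has_level :: "real^'q^'n \<Rightarrow> real \<Rightarrow> (real^'p^'n \<Rightarrow> real) \<Rightarrow> bool"
  where "has_level X \<alpha> \<phi> \<longleftrightarrow>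
    (\<forall>(B :: real^'q^'p) \<Sigma>. spd \<Sigma> \<longrightarrow> test_power X \<phi> B \<Sigma> (mat 1) = \<alpha>)"

end

theory Submission
  imports Defs
begin

text \<open>
  Choose \<open>L\<close>, \<open>R\<close> and some \<open>V\<close> with \<open>X L + V R = I\<close>, which is possible because \<open>X\<close> has rank \<open>q\<close>
  and \<open>n - q \<le> p\<close>. If \<open>N(Y) = X L + Y R\<close> is nonsingular, then the choice
  \<open>A\<^sup>T = I + R N(Y)\<^sup>-\<^sup>1 (V - Y)\<close>, \<open>C\<^sup>T = L N(Y)\<^sup>-\<^sup>1 (V - Y)\<close> carries \<open>Y\<close> to \<open>V\<close>, so an invariant
  function takes the value \<open>f V\<close> at \<open>Y\<close>. The exceptional set \<open>det N(Y) = 0\<close> is the zero set of a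
  nonzero polynomial, hence null for Lebesgue measure and for every nonsingular matrix normal law.
  That \<open>msqrt S\<close> is nonsingular rests on existence and uniqueness of the positive definite square root,
  both obtained from an orthonormal eigenbasis.
\<close>

section \<open>Linear algebra: orbits of the group and completion of X to full rank\<close>

lemma matrix_add_mult_distrib:
  fixes A B :: "'a::semiring_1^'m^'n"
  shows "(A + B) ** C = A ** C + B ** C"
  by (simp add: matrix_matrix_mult_def vec_eq_iff distrib_right sum.distrib)

text \<open>With \<open>W\<close> = (X L + Y R)^-1 (Y0 - Y), multiplying out gives X L W + Y R W =
  Y0 - Y, so C^T = L W and A^T = I + R W carry Y to Y0. Nonsingularity of the second matrix is where
  the hypothesis on Y0 enters: a kernel vector x satisfies x = - R W x, and applying the identity to
  x leaves (X L + Y0 R) W x = 0, hence W x = 0 and x = 0.\<close>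

lemma nonsingular_completions_same_orbit:
  fixes X :: "real^'q^'n" and Y Y0 :: "real^'p^'n" and L :: "real^'n^'q" and R :: "real^'n^'p"
  assumes Y: "det (X ** L + Y ** R) \<noteq> 0" and Y0: "det (X ** L + Y0 ** R) \<noteq> 0"
  obtains C :: "real^'q^'p" and A :: "real^'p^'p"
  where "invertible A" "Y0 = X ** transpose C + Y ** transpose A"
proof -
  obtain N where N: "(X ** L + Y ** R) ** N = mat 1"
    using Y unfolding invertible_det_nz[symmetric] invertible_def by blast
  define W where "W = N ** (Y0 - Y)"
  have W: "X ** (L ** W) + Y ** (R ** W) = Y0 - Y"
    by (simp add: W_def matrix_mul_assoc N flip: matrix_add_mult_distrib)
  define D where "D = mat 1 + R ** W"
  have "x = 0" if x: "D *v x = 0" for x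
  proof -
    have "x + R *v (W *v x) = 0"
      using x by (simp add: D_def matrix_vector_mult_add_rdistrib matrix_vector_mul_assoc)
    then have x_eq: "x = - (R *v (W *v x))"
      by (simp add: eq_neg_iff_add_eq_0)
    have "(X ** (L ** W) + Y ** (R ** W)) *v x = Y0 *v x - Y *v x"
      by (simp add: W matrix_vector_mult_diff_rdistrib)
    then have "X *v (L *v (W *v x)) + Y *v (R *v (W *v x)) = Y0 *v x - Y *v x"
      by (simp add: matrix_vector_mult_add_rdistrib matrix_vector_mul_assoc matrix_mul_assoc)
    moreover have "Y *v x = - (Y *v (R *v (W *v x)))" "Y0 *v x = - (Y0 *v (R *v (W *v x)))"
      by (metis x_eq linear_neg matrix_vector_mul_linear)+
    ultimately have "(X ** L + Y0 ** R) *v (W *v x) = 0"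
      by (simp add: matrix_vector_mult_add_rdistrib matrix_vector_mul_assoc[symmetric])
    then have "W *v x = 0"
      using Y0 by (metis invertible_det_nz invertible_left_inverse matrix_left_invertible_ker)
    with x_eq show "x = 0" by simp
  qed
  then have "invertible D"
    by (simp add: invertible_left_inverse matrix_left_invertible_ker)
  moreover have "Y0 = X ** (L ** W) + Y ** D"
    using W by (simp add: D_def matrix_add_ldistrib algebra_simps)
  ultimately show thesis
    using that[of "transpose D" "transpose (L ** W)"]
    by (simp add: invertible_det_nz)
qed

lemma span_columns_subset_range:
  fixes A :: "real^'n^'m"
  shows "span (columns A) \<subseteq> range ((*v) A)"
proof (rule span_minimal)
  show "columns A \<subseteq> range ((*v) A)"
    by (auto simp: columns_def matrix_vector_mult_basis[symmetric])
  show "subspace (range ((*v) A))"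
    by (intro linear_subspace_image) simp_all
qed

text \<open>Some q columns of X are independent; they extend to a basis of the whole space by n - q
  further vectors. As n - q is at most p, these fit among the columns of a matrix V, and then X and
  V together reach every vector.\<close>

lemma full_rank_completion:
  fixes X :: "real^'q^'n"
  assumes "rank X = CARD('q)" "CARD('n) \<le> CARD('p) + CARD('q)"
  obtains L :: "real^'n^'q" and R :: "real^'n^'p" and V :: "real^'p^'n"
  where "X ** L + V ** R = mat 1"
proof -
  obtain B0 where B0: "B0 \<subseteq> columns X" "independent B0" "columns X \<subseteq> span B0" "card B0 = dim (columns X)"
    using basis_exists by blast
  then obtain B where B: "B0 \<subseteq> B" "independent B" "UNIV \<subseteq> span B"
    using maximal_independent_subset_extend[of B0 UNIV] by auto
  have finB: "finite B" using B(2) independent_bound by blast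
  have "card B = CARD('n)"
    using B dim_eq_card[of B UNIV] by (auto simp: top.extremum_unique)
  moreover have "card B0 = CARD('q)"
    using B0 assms by (simp add: column_rank_def)
  ultimately have card: "card (B - B0) \<le> CARD('p)"
    using B finB assms by (simp add: card_Diff_subset finite_subset)
  have "\<exists>f :: 'p \<Rightarrow> real^'n. B - B0 \<subseteq> range f"
  proof -
    obtain g where g: "inj_on g (B - B0)" "g ` (B - B0) \<subseteq> (UNIV :: 'p set)"
      using card_le_inj[of "B - B0" "UNIV :: 'p set"] finB card by auto
    \<comment> \<open>Inverting the injection \<open>g\<close> gives a map on the column indices
      that hits every new basis vector. Indices outside the image of \<open>g\<close> receive
      arbitrary vectors, which cannot shrink the span.\<close>
    have "b \<in> range (the_inv_into (B - B0) g)" if "b \<in> B - B0" for b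
      using the_inv_into_f_f[OF g(1) that] by (metis rangeI)
    then show ?thesis by blast
  qed
  then obtain f :: "'p \<Rightarrow> real^'n" where f: "B - B0 \<subseteq> range f" ..
  define V :: "real^'p^'n" where "V = (\<chi> i j. f j $ i)"
  have colV: "columns V = range f"
    by (auto simp: columns_def column_def V_def)
  have "B \<subseteq> columns X \<union> columns V"
    using f B0 colV by auto
  then have sp: "span (columns X \<union> columns V) = UNIV"
    using B(3) span_mono by blast
  have "\<exists>a b. y = X *v a + V *v b" for y
  proof -
    have "y \<in> span (columns X \<union> columns V)" by (simp add: sp)
    then obtain u v where "u \<in> span (columns X)" "v \<in> span (columns V)" "y = u + v"
      by (auto simp: span_Un)
    then show ?thesis
      using span_columns_subset_range[of X] span_columns_subset_range[of V] by blast
  qed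
  then obtain a b where ab: "\<And>y. y = X *v a y + V *v b y" by metis
  \<comment> \<open>The columns of \<open>L\<close> and \<open>R\<close> are the coefficients that
    represent the unit vectors.\<close>
  define L where "L = (\<chi> k i. a (axis i 1) $ k)"
  define R where "R = (\<chi> k i. b (axis i 1) $ k)"
  have "column i (X ** L + V ** R) = axis i 1" for i
  proof -
    have "L *v axis i 1 = a (axis i 1)" "R *v axis i 1 = b (axis i 1)"
      by (simp_all add: matrix_vector_mult_basis L_def R_def column_def vec_eq_iff)
    then have "(X ** L + V ** R) *v axis i 1 = X *v a (axis i 1) + V *v b (axis i 1)"
      by (simp add: matrix_vector_mult_add_rdistrib matrix_vector_mul_assoc[symmetric])
    then show ?thesis using ab by (metis matrix_vector_mult_basis)
  qed
  then have "X ** L + V ** R = mat 1"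
    by (simp add: vec_eq_iff column_def mat_def axis_def)
  then show thesis using that by blast
qed

section \<open>Zero sets of determinants are Lebesgue null\<close>

lemma det_affine_polynomial:
  fixes A B :: "'a::comm_ring_1^'n^'n"
  shows "\<exists>p. \<forall>t. poly p t = det (A + (\<chi> i j. t * B $ i $ j))"
proof
  \<comment> \<open>Leibniz formula with each entry replaced by a polynomial of degree at most one
    in t.\<close>
  let ?p = "\<Sum>\<sigma> | \<sigma> permutes (UNIV :: 'n set). of_int (sign \<sigma>) * (\<Prod>i\<in>UNIV. [:A $ i $ \<sigma> i, B $ i $ \<sigma> i:])"
  show "\<forall>t. poly ?p t = det (A + (\<chi> i j. t * B $ i $ j))"
    by (simp add: det_def poly_sum poly_prod)
qed

text \<open>On each line through \<open>x0\<close> the zeros are finite in number, so by Fubini the dilation of the zero set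
  about \<open>x0\<close> by \<open>1 / t\<close> is null for almost every \<open>t\<close>; a single \<open>t \<noteq> 0\<close> suffices.\<close>

lemma AE_lborel_polynomial_on_lines_nonzero:
  fixes f :: "'a::euclidean_space \<Rightarrow> real"
  assumes [measurable]: "f \<in> borel_measurable borel"
    and x0: "f x0 \<noteq> 0"
    and poly: "\<And>y. \<exists>p. \<forall>t. poly p t = f (x0 + t *\<^sub>R y)"
  shows "AE x in lborel. f x \<noteq> 0"
proof -
  have "AE t in lborel. f (x0 + t *\<^sub>R y) \<noteq> 0" for y
  proof -
    obtain p where p: "\<And>t. poly p t = f (x0 + t *\<^sub>R y)" using poly by blast
    then have "p \<noteq> 0" using x0 p[of 0] by force
    then have "finite {t. f (x0 + t *\<^sub>R y) = 0}"
      using poly_roots_finite[of p] p by simp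
    then have "{t. f (x0 + t *\<^sub>R y) = 0} \<in> null_sets lborel"
      by (rule finite_imp_null_set_lborel)
    then show ?thesis by (rule AE_I') auto
  qed
  then have "AE y in lborel. AE t in lborel. f (x0 + t *\<^sub>R y) \<noteq> 0" by simp
  moreover have "{z \<in> space (lborel \<Otimes>\<^sub>M lborel). f (x0 + snd z *\<^sub>R fst z) \<noteq> 0}
      \<in> sets (lborel \<Otimes>\<^sub>M lborel)"
    by measurable
  ultimately have "AE t in lborel. AE y in lborel. f (x0 + t *\<^sub>R y) \<noteq> 0"
    using lborel_pair.AE_commute[where P = "\<lambda>y t. f (x0 + t *\<^sub>R y) \<noteq> 0"] by blast
  \<comment> \<open>At t = 0 the inner statement is trivial and says nothing about the zero set, so
    that value is discarded. Since \<open>lborel\<close> on the reals is not the zero measure, some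
    good t remains.\<close>
  then have "AE t::real in lborel. t \<noteq> 0 \<and> (AE y in lborel. f (x0 + t *\<^sub>R y) \<noteq> 0)"
    using AE_lborel_singleton[of 0] by eventually_elim auto
  moreover have "ae_filter (lborel :: real measure) \<noteq> bot"
    by (simp add: ae_filter_eq_bot_iff)
  ultimately obtain t :: real where "t \<noteq> 0" and t: "AE y in lborel. f (x0 + t *\<^sub>R y) \<noteq> 0"
    using eventually_happens' by blast
  then show ?thesis
    by (subst lborel_affine[OF \<open>t \<noteq> 0\<close>, of x0]) (simp add: AE_density AE_distr_iff)
qed

lemma AE_lborel_det_affine_nonzero:
  fixes F :: "'a::euclidean_space \<Rightarrow> real^'n^'n"
  assumes F: "linear F" and x0: "det (A + F x0) \<noteq> 0"
  shows "AE x in lborel. det (A + F x) \<noteq> 0"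
proof (rule AE_lborel_polynomial_on_lines_nonzero[where ?x0.0 = x0])
  have "continuous_on UNIV (\<lambda>x. det (A + F x))"
    unfolding det_def using F
    by (intro continuous_intros linear_continuous_on) (auto simp: linear_conv_bounded_linear)
  then show "(\<lambda>x. det (A + F x)) \<in> borel_measurable borel"
    by (rule borel_measurable_continuous_onI)
  fix y
  have "A + F (x0 + t *\<^sub>R y) = A + F x0 + (\<chi> i j. t * F y $ i $ j)" for t
    using F by (simp add: linear_add linear_scale vec_eq_iff algebra_simps)
  then show "\<exists>p. \<forall>t. poly p t = det (A + F (x0 + t *\<^sub>R y))"
    using det_affine_polynomial[of "A + F x0" "F y"] by metis
qed (use x0 in simp)

section \<open>Absolute continuity of the standard normal matrix\<close>

lemma PiM_density_lborel:
  fixes f :: "real \<Rightarrow> ennreal"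
  assumes I: "finite I" and f[measurable]: "f \<in> borel_measurable borel"
    and sf: "sigma_finite_measure (density lborel f)"
  shows "PiM I (\<lambda>i. density lborel f) = density (PiM I (\<lambda>i. lborel)) (\<lambda>x. \<Prod>i\<in>I. f (x i))"
proof -
  interpret D: product_sigma_finite "\<lambda>i. density lborel f" using sf by (simp add: product_sigma_finite_def)
  interpret L: product_sigma_finite "\<lambda>i. lborel :: real measure"
    by (simp add: product_sigma_finite_def sigma_finite_lborel)
  show ?thesis
  \<comment> \<open>A product measure is determined by its values on boxes. There the indicator is a
    product of indicators, so the integral factors over the coordinates.\<close>
  proof (rule D.PiM_eqI[symmetric])
    fix A assume A: "\<And>i. i \<in> I \<Longrightarrow> A i \<in> sets (density lborel f)"
    then have Am: "\<And>i. i \<in> I \<Longrightarrow> A i \<in> sets borel" by simp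
    have P: "Pi\<^sub>E I A \<in> sets (PiM I (\<lambda>i. lborel))"
      using A I by (intro sets_PiM_I_finite) auto
    have "emeasure (density (PiM I (\<lambda>i. lborel)) (\<lambda>x. \<Prod>i\<in>I. f (x i))) (Pi\<^sub>E I A)
        = (\<integral>\<^sup>+x. (\<Prod>i\<in>I. f (x i)) * indicator (Pi\<^sub>E I A) x \<partial>PiM I (\<lambda>i. lborel))"
      using P by (intro emeasure_density) auto
    also have "\<dots> = (\<integral>\<^sup>+x. (\<Prod>i\<in>I. f (x i) * indicator (A i) (x i)) \<partial>PiM I (\<lambda>i. lborel))"
    proof (rule nn_integral_cong)
      fix x assume "x \<in> space (PiM I (\<lambda>i. lborel :: real measure))"
      then have "indicator (Pi\<^sub>E I A) x = (\<Prod>i\<in>I. indicator (A i) (x i) :: ennreal)"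
        using I by (auto simp: indicator_def space_PiM PiE_def Pi_def)
      then show "(\<Prod>i\<in>I. f (x i)) * indicator (Pi\<^sub>E I A) x = (\<Prod>i\<in>I. f (x i) * indicator (A i) (x i))"
        by (simp add: prod.distrib)
    qed
    also have "\<dots> = (\<Prod>i\<in>I. \<integral>\<^sup>+x. f x * indicator (A i) x \<partial>lborel)"
      using I Am by (intro L.product_nn_integral_prod) auto
    also have "\<dots> = (\<Prod>i\<in>I. emeasure (density lborel f) (A i))"
      using Am by (intro prod.cong refl) (simp add: emeasure_density)
    finally show "emeasure (density (PiM I (\<lambda>i. lborel)) (\<lambda>x. \<Prod>i\<in>I. f (x i))) (Pi\<^sub>E I A)
        = (\<Prod>i\<in>I. emeasure (density lborel f) (A i))" .
  qed (use I in \<open>auto intro!: sets_PiM_cong\<close>)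
qed

lemma measurable_matrix_of_family [measurable]:
  "(\<lambda>z. \<chi> i j. z (i, j) :: real^'p^'n) \<in> borel_measurable (PiM UNIV (\<lambda>_. lborel))"
proof -
  have "(\<lambda>z. (\<chi> i j. z (i, j)) \<bullet> (b :: real^'p^'n)) \<in> borel_measurable (PiM UNIV (\<lambda>_. lborel))" for b
    unfolding inner_vec_def by simp
  then show ?thesis
    by (subst borel_measurable_euclidean_space) blast
qed

text \<open>This links Lebesgue measure on matrices to the product over entries through which
  \<open>std_normal_matrix\<close> is defined. Lebesgue measure is determined by the volumes of open
  boxes, and the preimage of a box of matrices is a product of intervals.\<close>

lemma lborel_matrix_eq:
  "(lborel :: (real^'p^'n) measure) = distr (PiM UNIV (\<lambda>_. lborel)) borel (\<lambda>z. \<chi> i j. z (i, j))"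
proof (rule lborel_eqI)
  interpret L: product_sigma_finite "\<lambda>i::'n\<times>'p. lborel :: real measure"
    by (simp add: product_sigma_finite_def sigma_finite_lborel)
  fix l u :: "real^'p^'n"
  assume le: "\<And>b. b \<in> Basis \<Longrightarrow> l \<bullet> b \<le> u \<bullet> b"
  \<comment> \<open>Indexing the basis by entry positions turns the product over
    \<open>Basis\<close> into a product over index pairs.\<close>
  define e :: "'n \<times> 'p \<Rightarrow> real^'p^'n" where "e = (\<lambda>(i, j). axis i (axis j 1))"
  have inner_e: "x \<bullet> e (i, j) = x $ i $ j" for x i j
    by (simp add: e_def inner_axis)
  have Basis_eq: "Basis = range e"
    by (auto simp: Basis_vec_def e_def image_def)
  have inj_e: "inj e"
    by (auto simp: inj_on_def e_def axis_eq_axis)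
  have "emeasure (distr (PiM UNIV (\<lambda>_. lborel)) borel (\<lambda>z. \<chi> i j. z (i, j))) (box l u)
      = emeasure (PiM UNIV (\<lambda>_. lborel)) (Pi\<^sub>E UNIV (\<lambda>(i, j). {l $ i $ j <..< u $ i $ j}))"
    by (subst emeasure_distr[OF _ borel_open[OF open_box]])
      (auto intro!: arg_cong2[where f = emeasure] simp: space_PiM box_def Basis_eq inner_e PiE_def Pi_def)
  also have "\<dots> = (\<Prod>(i, j)\<in>UNIV. emeasure lborel {l $ i $ j <..< u $ i $ j})"
    by (subst L.emeasure_PiM) (auto simp: split_beta')
  also have "\<dots> = (\<Prod>ij\<in>UNIV. ennreal ((u - l) \<bullet> e ij))"
  proof (intro prod.cong refl)
    fix ij :: "'n \<times> 'p"
    obtain i j where ij: "ij = (i, j)" by fastforce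
    have "l $ i $ j \<le> u $ i $ j"
      using le[of "e (i, j)"] by (simp add: Basis_eq inner_e)
    then show "(case ij of (i, j) \<Rightarrow> emeasure lborel {l $ i $ j <..< u $ i $ j}) = ennreal ((u - l) \<bullet> e ij)"
      by (simp add: ij inner_e)
  qed
  also have "\<dots> = ennreal (\<Prod>b\<in>Basis. (u - l) \<bullet> b)"
    using le by (simp add: Basis_eq prod.reindex[OF inj_e] prod_ennreal inner_diff_left)
  finally show "emeasure (distr (PiM UNIV (\<lambda>_. lborel)) borel (\<lambda>z. \<chi> i j. z (i, j))) (box l u)
      = ennreal (\<Prod>b\<in>Basis. (u - l) \<bullet> b)" .
qed simp

lemma std_normal_PiM_eq:
  "PiM UNIV (\<lambda>_ :: 'i::finite. std_normal_distribution)
    = density (PiM UNIV (\<lambda>_. lborel)) (\<lambda>x. \<Prod>i\<in>UNIV. ennreal (std_normal_density (x i)))"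
proof (rule PiM_density_lborel)
  interpret prob_space std_normal_distribution by (rule prob_space_normal_density) simp
  show "sigma_finite_measure std_normal_distribution" ..
qed simp_all

lemma measurable_matrix_of_std_normal:
  "(\<lambda>z. \<chi> i j. z (i, j) :: real^'p^'n) \<in> borel_measurable (PiM UNIV (\<lambda>_. std_normal_distribution))"
  unfolding std_normal_PiM_eq by measurable

text \<open>Pulled back to families of entries, the normal law has a density with respect to the
  Lebesgue product, so Lebesgue null sets remain null.\<close>

lemma AE_std_normal_matrix:
  assumes [measurable]: "Measurable.pred borel P" and "AE Z in lborel. P Z"
  shows "AE Z in std_normal_matrix. P (Z :: real^'p^'n)"
proof -
  have "AE z in PiM UNIV (\<lambda>_. lborel). P (\<chi> i j. z (i, j))"
    using assms(2) by (subst (asm) lborel_matrix_eq) (simp add: AE_distr_iff)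
  then have "AE z in PiM UNIV (\<lambda>_. std_normal_distribution). P (\<chi> i j. z (i, j))"
    unfolding std_normal_PiM_eq by (subst AE_density) auto
  then show ?thesis
    unfolding std_normal_matrix_def
    by (subst AE_distr_iff) (use measurable_matrix_of_std_normal in auto)
qed

lemma prob_space_std_normal_matrix: "prob_space (std_normal_matrix :: (real^'p^'n) measure)"
  unfolding std_normal_matrix_def
  by (intro prob_space.prob_space_distr prob_space_PiM prob_space_normal_density measurable_matrix_of_std_normal) simp

section \<open>Spectral theorem and the positive definite square root\<close>

lemma Rayleigh_maximizer_eigenvector:
  fixes S :: "real^'k^'k"
  assumes S: "transpose S = S" and V: "subspace V" "\<And>v. v \<in> V \<Longrightarrow> S *v v \<in> V" "V \<noteq> {0}"
  obtains x \<mu> where "x \<in> V" "norm x = 1" "S *v x = \<mu> *\<^sub>R x"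
proof -
  have sym: "x \<bullet> (S *v y) = y \<bullet> (S *v x)" for x y
    by (metis S dot_lmul_matrix inner_commute transpose_matrix_vector)
  define K where "K = V \<inter> sphere 0 1"
  obtain v where v: "v \<in> V" "v \<noteq> 0" using V subspace_0 by blast
  then have "inverse (norm v) *\<^sub>R v \<in> K"
    using V by (auto simp: K_def subspace_scale)
  moreover have "compact K"
    unfolding K_def using V by (intro closed_Int_compact closed_subspace) auto
  moreover have "continuous_on K (\<lambda>y. y \<bullet> (S *v y))"
    by (intro continuous_on_inner continuous_on_id matrix_vector_mult_linear_continuous_on)
  ultimately obtain x where x: "x \<in> K" and max: "\<And>y. y \<in> K \<Longrightarrow> y \<bullet> (S *v y) \<le> x \<bullet> (S *v x)"
    using continuous_attains_sup[of K "\<lambda>y. y \<bullet> (S *v y)"]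
    by blast
  define \<mu> where "\<mu> = x \<bullet> (S *v x)"
  have xV: "x \<in> V" and nx: "norm x = 1" using x by (auto simp: K_def)
  have ge: "y \<bullet> (S *v y) \<le> \<mu> * (y \<bullet> y)" if "y \<in> V" for y
  proof (cases "y = 0")
    case False
    let ?y = "inverse (norm y) *\<^sub>R y"
    have "?y \<in> K" using False that V by (auto simp: K_def subspace_scale)
    from max[OF this] have "inverse (norm y) * inverse (norm y) * (y \<bullet> (S *v y)) \<le> \<mu>"
      by (simp add: \<mu>_def matrix_vector_mult_scaleR mult.assoc)
    then show ?thesis using False by (simp add: field_simps power2_norm_eq_inner[symmetric] power2_eq_square)
  qed simp
  \<comment> \<open>The residual \<open>w\<close> measures the failure of the maximizer x to be an
    eigenvector. If it were nonzero, moving x slightly towards \<open>w\<close> would raise the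
    Rayleigh quotient above its maximum \<open>\<mu>\<close>.\<close>
  define w where "w = S *v x - \<mu> *\<^sub>R x"
  have wV: "w \<in> V" using V xV by (auto simp: w_def subspace_diff subspace_scale)
  have q: "2 * t * (w \<bullet> w) \<le> t\<^sup>2 * (\<mu> * (w \<bullet> w) - w \<bullet> (S *v w))" for t
  proof -
    have "x + t *\<^sub>R w \<in> V" using V xV wV by (simp add: subspace_add subspace_scale)
    from ge[OF this] have "\<mu> + 2 * t * (w \<bullet> (S *v x)) + t\<^sup>2 * (w \<bullet> (S *v w))
        \<le> \<mu> * (x \<bullet> x + 2 * t * (w \<bullet> x) + t\<^sup>2 * (w \<bullet> w))"
      using sym[of x w]
      by (simp add: \<mu>_def matrix_vector_right_distrib matrix_vector_mult_scaleR inner_add_left inner_add_right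
          inner_commute[of x w] power2_eq_square algebra_simps)
    moreover have "x \<bullet> x = 1" using nx by (simp add: dot_square_norm)
    moreover have "w \<bullet> (S *v x) = w \<bullet> w + \<mu> * (w \<bullet> x)"
      by (subst (3) w_def) (simp add: inner_diff_right)
    ultimately have "\<mu> + 2 * t * (w \<bullet> w + \<mu> * (w \<bullet> x)) + t\<^sup>2 * (w \<bullet> (S *v w))
        \<le> \<mu> * (1 + 2 * t * (w \<bullet> x) + t\<^sup>2 * (w \<bullet> w))"
      by simp
    then show ?thesis by (simp add: algebra_simps)
  qed
  define c where "c = \<mu> * (w \<bullet> w) - w \<bullet> (S *v w)"
  have "w \<bullet> w \<le> 0"
  proof (rule ccontr)
    assume "\<not> w \<bullet> w \<le> 0"
    then have pos: "w \<bullet> w > 0" by (simp only: not_le)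
    \<comment> \<open>This step is so small that t * c is at most w . w, whereas \<open>q\<close>
      forces it to be at least twice w . w.\<close>
    define t where "t = (w \<bullet> w) / (\<bar>c\<bar> + 1)"
    have t: "t > 0" unfolding t_def using pos by (intro divide_pos_pos) auto
    have "2 * t * (w \<bullet> w) \<le> t * (t * c)" using q[of t] by (simp add: c_def power2_eq_square)
    then have "2 * (w \<bullet> w) \<le> t * c" using t by (simp add: mult.left_commute mult.assoc)
    also have "t * c \<le> t * (\<bar>c\<bar> + 1)" using t by (intro mult_left_mono) auto
    also have "\<dots> = w \<bullet> w" by (simp add: t_def add_nonneg_eq_0_iff)
    finally show False using pos by simp
  qed
  then have "w = 0"
    by (metis inner_eq_zero_iff inner_ge_zero antisym)
  then have "S *v x = \<mu> *\<^sub>R x"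
    by (simp add: w_def)
  then show thesis using that xV nx by blast
qed

text \<open>Induction on the dimension: split off a unit eigenvector x. By symmetry of S, its
  orthogonal complement within V is again invariant, and it has smaller dimension. Arbitrary
  invariant subspaces are allowed so that the induction applies to this complement.\<close>

lemma orthonormal_eigenbasis_subspace:
  fixes S :: "real^'k^'k"
  assumes S: "transpose S = S" and "subspace V" "\<And>v. v \<in> V \<Longrightarrow> S *v v \<in> V"
  shows "\<exists>B. finite B \<and> pairwise orthogonal B \<and> span B = V \<and> (\<forall>b\<in>B. norm b = 1 \<and> (\<exists>\<mu>. S *v b = \<mu> *\<^sub>R b))"
  using assms(2,3)
proof (induction "dim V" arbitrary: V rule: less_induct)
  case less
  show ?case
  proof (cases "V = {0}")
    case True
    then show ?thesis by (intro exI[of _ "{}"]) auto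
  next
    case False
    with less.prems S obtain x \<mu> where x: "x \<in> V" "norm x = 1" "S *v x = \<mu> *\<^sub>R x"
      using Rayleigh_maximizer_eigenvector by blast
    define W where "W = {v \<in> V. x \<bullet> v = 0}"
    have W: "subspace W"
      using less.prems(1) by (auto simp: W_def subspace_def inner_add_right)
    have SW: "S *v v \<in> W" if "v \<in> W" for v
    proof -
      have "x \<bullet> (S *v v) = (S *v x) \<bullet> v"
        by (metis S dot_lmul_matrix transpose_matrix_vector)
      then show ?thesis using that x less.prems(2) by (simp add: W_def)
    qed
    have "x \<notin> W" using x by (auto simp: W_def dot_square_norm)
    then have "W \<subset> V" using x(1) unfolding W_def by blast
    then have "dim W < dim V"
      using W less.prems(1) by (metis dim_psubset span_eq_iff)
    from less.hyps[OF this W SW] obtain B where B: "finite B" "pairwise orthogonal B" "span B = W"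
      "\<forall>b\<in>B. norm b = 1 \<and> (\<exists>\<mu>. S *v b = \<mu> *\<^sub>R b)" by blast
    have BW: "B \<subseteq> W" using B(3) span_superset by blast
    have "span (insert x B) = V"
    proof
      show "span (insert x B) \<subseteq> V"
        using BW x less.prems(1) by (intro span_minimal) (auto simp: W_def)
      show "V \<subseteq> span (insert x B)"
      proof
        fix v assume v: "v \<in> V"
        then have "v - (x \<bullet> v) *\<^sub>R x \<in> W"
          using x less.prems(1) by (auto simp: W_def subspace_diff subspace_scale inner_diff_right dot_square_norm)
        then show "v \<in> span (insert x B)"
          unfolding span_insert using B(3) by blast
      qed
    qed
    moreover have "pairwise orthogonal (insert x B)"
      using B(2) BW by (auto simp: pairwise_insert W_def orthogonal_def inner_commute)
    ultimately show ?thesis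
      using B x by (intro exI[of _ "insert x B"]) auto
  qed
qed

lemma orthonormal_eigenbasis:
  fixes S :: "real^'k^'k"
  assumes "transpose S = S"
  obtains B l where "finite B" "span B = UNIV" "\<And>b. b \<in> B \<Longrightarrow> S *v b = l b *\<^sub>R b"
    "\<And>b c. b \<in> B \<Longrightarrow> c \<in> B \<Longrightarrow> b \<bullet> c = (if b = c then 1 else 0)"
proof -
  obtain B where B: "finite B" "pairwise orthogonal B" "span B = UNIV"
    "\<And>b. b \<in> B \<Longrightarrow> norm b = 1" "\<And>b. b \<in> B \<Longrightarrow> \<exists>\<mu>. S *v b = \<mu> *\<^sub>R b"
    using orthonormal_eigenbasis_subspace[OF assms subspace_UNIV] by auto
  from B(5) obtain l where "\<And>b. b \<in> B \<Longrightarrow> S *v b = l b *\<^sub>R b" by metis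
  moreover have "b \<bullet> c = (if b = c then 1 else 0)" if "b \<in> B" "c \<in> B" for b c
    using B(2,4) that by (auto simp: pairwise_def orthogonal_def dot_square_norm)
  ultimately show thesis using that B by blast
qed

lemma matrix_eq_on_span:
  fixes A B :: "real^'k^'n"
  assumes "span E = UNIV" "\<And>b. b \<in> E \<Longrightarrow> A *v b = B *v b"
  shows "A = B"
  using linear_eq_on_span[OF matrix_vector_mul_linear matrix_vector_mul_linear, of E A B] assms
  by (simp add: matrix_eq)

text \<open>Scale each vector of an orthonormal eigenbasis by the square root of its eigenvalue,
  which is positive because S is positive definite.\<close>

lemma spd_sqrt_exists:
  fixes S :: "real^'k^'k"
  assumes "spd S"
  shows "\<exists>R. spd R \<and> R ** R = S"
proof -
  from assms have S: "transpose S = S" and pos: "\<And>x. x \<noteq> 0 \<Longrightarrow> x \<bullet> (S *v x) > 0"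
    by (auto simp: spd_def)
  obtain B l where B: "finite B" "span B = UNIV" "\<And>b. b \<in> B \<Longrightarrow> S *v b = l b *\<^sub>R b"
    "\<And>b c. b \<in> B \<Longrightarrow> c \<in> B \<Longrightarrow> b \<bullet> c = (if b = c then 1 else 0)"
    using orthonormal_eigenbasis[OF S] by blast
  have lpos: "l b > 0" if "b \<in> B" for b
  proof -
    have "b \<bullet> b = 1" using B(4)[OF that that] by simp
    then have "b \<noteq> 0" by auto
    from pos[OF this] show ?thesis using \<open>b \<bullet> b = 1\<close> that B(3) by simp
  qed
  define r where "r y = (\<Sum>b\<in>B. (sqrt (l b) * (b \<bullet> y)) *\<^sub>R b)" for y
  have lin: "linear r"
    by (intro linearI) (simp_all add: r_def inner_add_right algebra_simps sum.distrib scaleR_sum_right)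
  define R where "R = matrix r"
  have R: "R *v y = r y" for y
    using lin by (simp add: R_def matrix_works)
  \<comment> \<open>This diagonal form shows at once that R is symmetric and, at y = x, that its
    quadratic form is a sum of nonnegative terms.\<close>
  have xR: "x \<bullet> (R *v y) = (\<Sum>b\<in>B. sqrt (l b) * (b \<bullet> x) * (b \<bullet> y))" for x y
    unfolding R r_def inner_sum_right inner_scaleR_right
    by (intro sum.cong refl) (metis inner_commute mult.assoc mult.commute)
  have Rb: "R *v b = sqrt (l b) *\<^sub>R b" if "b \<in> B" for b
  proof -
    have "R *v b = (\<Sum>c\<in>B. if c = b then sqrt (l b) *\<^sub>R b else 0)"
      unfolding R r_def using B(4) that by (intro sum.cong) auto
    then show ?thesis using that B(1) by simp
  qed
  have "R ** R = S"
  proof (rule matrix_eq_on_span[OF B(2)])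
    fix b assume "b \<in> B"
    then show "(R ** R) *v b = S *v b"
      using lpos[of b] B(3) by (simp add: matrix_vector_mul_assoc[symmetric] Rb matrix_vector_mult_scaleR)
  qed
  moreover have "transpose R = R"
  proof -
    have "x \<bullet> (transpose R *v y) = x \<bullet> (R *v y)" for x y
    proof -
      have "x \<bullet> (transpose R *v y) = y \<bullet> (R *v x)"
        by (simp add: dot_lmul_matrix inner_commute[of x])
      also have "\<dots> = x \<bullet> (R *v y)"
        unfolding xR by (intro sum.cong refl) (simp only: mult_ac)
      finally show ?thesis .
    qed
    then have "transpose R *v y = R *v y" for y
      using vector_eq_ldot by blast
    then show ?thesis unfolding matrix_eq by blast
  qed
  moreover have "x \<bullet> (R *v x) > 0" if "x \<noteq> 0" for x
  proof -
    \<comment> \<open>A vector orthogonal to a spanning set is orthogonal to itself.\<close>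
    have "\<exists>b\<in>B. b \<bullet> x \<noteq> 0"
    proof (rule ccontr)
      assume "\<not> (\<exists>b\<in>B. b \<bullet> x \<noteq> 0)"
      then have "orthogonal x b" if "b \<in> B" for b
        using that by (auto simp: orthogonal_def inner_commute)
      then have "orthogonal x x"
        using orthogonal_to_span[of x B x] B(2) by blast
      with \<open>x \<noteq> 0\<close> show False by (simp add: orthogonal_self)
    qed
    then obtain b where b: "b \<in> B" "b \<bullet> x \<noteq> 0" by blast
    have "(\<Sum>b\<in>B. sqrt (l b) * (b \<bullet> x)\<^sup>2) > 0"
    proof (rule sum_pos2[OF B(1) b(1)])
      show "0 < sqrt (l b) * (b \<bullet> x)\<^sup>2"
        using b lpos[OF b(1)] by (intro mult_pos_pos) auto
      show "0 \<le> sqrt (l c) * (c \<bullet> x)\<^sup>2" if "c \<in> B" for c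
        using lpos[OF that] by (intro mult_nonneg_nonneg) auto
    qed
    then show ?thesis by (simp add: xR power2_eq_square mult.assoc)
  qed
  ultimately show ?thesis unfolding spd_def by blast
qed

text \<open>The difference D = R - T is symmetric and satisfies R D + D T = R R - T T = 0. Pairing
  this with an eigenvector b of D gives its eigenvalue times (b . R b + b . T b) = 0. The bracket is
  positive, so all eigenvalues of D vanish.\<close>

lemma spd_sqrt_unique:
  fixes R T :: "real^'k^'k"
  assumes "spd R" "spd T" and eq: "R ** R = T ** T"
  shows "R = T"
proof -
  define D where "D = R - T"
  have "transpose R = R" "transpose T = T"
    using assms by (simp_all add: spd_def)
  moreover have "transpose D = transpose R - transpose T"
    by (simp add: D_def transpose_def vec_eq_iff)
  ultimately have "transpose D = D" by (simp add: D_def)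
  obtain B l where B: "finite B" "span B = UNIV" "\<And>b. b \<in> B \<Longrightarrow> D *v b = l b *\<^sub>R b"
    "\<And>b c. b \<in> B \<Longrightarrow> c \<in> B \<Longrightarrow> b \<bullet> c = (if b = c then 1 else 0)"
    using orthonormal_eigenbasis[OF \<open>transpose D = D\<close>] by blast
  have RT: "R *v (D *v y) + D *v (T *v y) = 0" for y
  proof -
    have "R *v (R *v y) = T *v (T *v y)"
      using eq by (simp add: matrix_vector_mul_assoc)
    then show ?thesis
      by (simp add: D_def matrix_vector_mult_diff_rdistrib matrix_vector_mult_diff_distrib)
  qed
  have "D *v b = 0" if b: "b \<in> B" for b
  proof -
    have "b \<noteq> 0" using B(4)[OF b b] by auto
    have "b \<bullet> (D *v (T *v b)) = (D *v b) \<bullet> (T *v b)"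
      using \<open>transpose D = D\<close> by (metis dot_lmul_matrix transpose_matrix_vector)
    then have "b \<bullet> (R *v (D *v b)) + (D *v b) \<bullet> (T *v b) = 0"
      using arg_cong[OF RT[of b], of "(\<bullet>) b"] by (simp add: inner_add_right)
    then have "l b * (b \<bullet> (R *v b) + b \<bullet> (T *v b)) = 0"
      using B(3)[OF b] by (simp add: matrix_vector_mult_scaleR algebra_simps)
    moreover have "b \<bullet> (R *v b) > 0" "b \<bullet> (T *v b) > 0"
      using assms \<open>b \<noteq> 0\<close> by (auto simp: spd_def)
    ultimately have "l b = 0" by simp
    then show ?thesis using B(3)[OF b] by simp
  qed
  then have "D = 0" by (intro matrix_eq_on_span[OF B(2)]) simp
  then show ?thesis by (simp add: D_def)
qed

lemma spd_msqrt:
  assumes "spd S"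
  shows "spd (msqrt S)"
proof -
  obtain R where R: "spd R" "R ** R = S"
    using spd_sqrt_exists[OF assms] by blast
  have "msqrt S = R"
    unfolding msqrt_def
  proof (rule the_equality)
    show "spd R \<and> R ** R = S" using R by blast
    show "T = R" if "spd T \<and> T ** T = S" for T
      using spd_sqrt_unique[of T R] R that by metis
  qed
  with R show ?thesis by simp
qed

lemma invertible_spd: "spd S \<Longrightarrow> invertible S"
  unfolding invertible_left_inverse matrix_left_invertible_ker spd_def
  by (metis inner_zero_right less_irrefl)

lemma spd_mat_1: "spd (mat 1)"
  by (simp add: spd_def)

section \<open>Constancy of invariant functions and the power of invariant tests\<close>

lemma linear_matrix_sandwich: "linear (\<lambda>Z. P ** Z ** Q)"
  for P :: "real^'n^'m" and Q :: "real^'q^'p"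
proof (rule linearI)
  fix c :: real and Z :: "real^'p^'n"
  have "P ** (c *\<^sub>R Z) = c *\<^sub>R (P ** Z)"
    by (simp add: matrix_matrix_mult_def vec_eq_iff sum_distrib_left mult.left_commute)
  moreover have "(c *\<^sub>R W) ** Q = c *\<^sub>R (W ** Q)" for W :: "real^'p^'m"
    by (simp add: matrix_matrix_mult_def vec_eq_iff sum_distrib_left mult.assoc)
  ultimately show "P ** (c *\<^sub>R Z) ** Q = c *\<^sub>R (P ** Z ** Q)"
    by simp
qed (simp add: matrix_add_ldistrib matrix_add_mult_distrib)

theorem corollary1:
  fixes X :: "real^'q^'n"
  assumes "rank X = CARD('q)"
    and "CARD('q) < CARD('n)"
    and "CARD('n) \<le> CARD('p) + CARD('q)"
  shows "(\<forall>f :: real^'p^'n \<Rightarrow> 'c. invariant_under (transformations X) f \<longrightarrow>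
            (\<exists>c. AE Y in lborel. f Y = c)) \<and>
         (\<forall>(\<phi> :: real^'p^'n \<Rightarrow> real) \<alpha>.
            randomized_test \<phi> \<longrightarrow> invariant_under (transformations X) \<phi> \<longrightarrow> has_level X \<alpha> \<phi> \<longrightarrow>
            (\<forall>(B :: real^'q^'p) \<Sigma> \<Psi>. spd \<Sigma> \<longrightarrow> spd \<Psi> \<longrightarrow> test_power X \<phi> B \<Sigma> \<Psi> = \<alpha>))"
proof -
  obtain L :: "real^'n^'q" and R :: "real^'n^'p" and V :: "real^'p^'n" where LRV: "X ** L + V ** R = mat 1"
    using full_rank_completion[OF assms(1,3)] by blast
  \<comment> \<open>The value type \<open>'d\<close> is left general so that the fact serves both
    functions into \<open>'c\<close> and real-valued tests.\<close>
  have const: "f Y = f V"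
    if f: "invariant_under (transformations X) f" and Y: "det (X ** L + Y ** R) \<noteq> 0"
    for f :: "real^'p^'n \<Rightarrow> 'd" and Y
  proof -
    have "det (X ** L + V ** R) \<noteq> 0" by (simp add: LRV)
    then obtain C :: "real^'q^'p" and A :: "real^'p^'p"
      where "invertible A" "V = X ** transpose C + Y ** transpose A"
      using nonsingular_completions_same_orbit[OF Y] by blast
    then have "(\<lambda>Y. X ** transpose C + Y ** transpose A) \<in> transformations X"
      unfolding transformations_def by blast
    then show ?thesis
      using f \<open>V = _\<close> unfolding invariant_under_def by fastforce
  qed
  have generic: "AE Z in lborel. det (X ** L + (M + P ** Z ** Q) ** R) \<noteq> 0"
    if P: "invertible P" and Q: "invertible Q"
    for M :: "real^'p^'n" and P :: "real^'n^'n" and Q :: "real^'p^'p"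
  proof -
    obtain P' Q' where "P ** P' = mat 1" "Q' ** Q = mat 1"
      using P Q unfolding invertible_def by blast
    \<comment> \<open>The point Z = P' (V - M) Q' solves M + P Z Q = V. There the matrix in question
      is the identity, so its determinant does not vanish identically.\<close>
    then have "P ** (P' ** (V - M) ** Q') ** Q = V - M"
      by (metis matrix_mul_assoc matrix_mul_lid matrix_mul_rid)
    then have "X ** L + M ** R + P ** (P' ** (V - M) ** Q') ** (Q ** R) = mat 1"
      using LRV by (simp add: matrix_mul_assoc add.assoc flip: matrix_add_mult_distrib)
    then have "det (X ** L + M ** R + P ** (P' ** (V - M) ** Q') ** (Q ** R)) \<noteq> 0"
      by simp
    from AE_lborel_det_affine_nonzero[OF linear_matrix_sandwich this] show ?thesis
      by (simp add: matrix_add_mult_distrib matrix_mul_assoc add.assoc)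
  qed
  have "AE Y in lborel. f Y = f V" if "invariant_under (transformations X) f" for f :: "real^'p^'n \<Rightarrow> 'c"
  proof (rule eventually_mono)
    \<comment> \<open>Y is written as an affine image of itself to match \<open>generic\<close> with
      M = 0 and P, Q identities.\<close>
    show "AE Y in lborel. det (X ** L + (0 + mat 1 ** Y ** mat 1) ** R) \<noteq> 0"
      by (intro generic invertible_spd spd_mat_1)
  qed (use const[OF that] in simp)
  moreover have power: "test_power X \<phi> B \<Sigma> \<Psi> = \<phi> V"
    if \<phi>: "randomized_test \<phi>" "invariant_under (transformations X) \<phi>" and spd: "spd \<Sigma>" "spd \<Psi>"
    for \<phi> :: "real^'p^'n \<Rightarrow> real" and B :: "real^'q^'p" and \<Sigma> \<Psi>
  proof -
    let ?g = "\<lambda>Z. X ** transpose B + msqrt \<Psi> ** Z ** msqrt \<Sigma>"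
    have \<phi>_meas [measurable]: "\<phi> \<in> borel_measurable borel" using \<phi>(1) by (simp add: randomized_test_def)
    have "continuous_on UNIV ?g"
      using linear_matrix_sandwich[of "msqrt \<Psi>" "msqrt \<Sigma>"]
      by (intro continuous_on_add continuous_on_const linear_continuous_on) (simp add: linear_conv_bounded_linear)
    then have g_meas [measurable]: "?g \<in> borel_measurable borel"
      by (rule borel_measurable_continuous_onI)
    interpret N: prob_space "std_normal_matrix :: (real^'p^'n) measure"
      by (rule prob_space_std_normal_matrix)
    \<comment> \<open>The exceptional set is handled in terms of Z, before the affine map
      \<open>?g\<close> is applied, so a density is needed only for the standard normal matrix and
      not for each matrix normal law.\<close>
    have "AE Z in lborel. \<phi> (?g Z) = \<phi> V"
    proof (rule eventually_mono)
      show "AE Z in lborel. det (X ** L + ?g Z ** R) \<noteq> 0"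
        using spd by (intro generic invertible_spd spd_msqrt)
    qed (rule const[OF \<phi>(2)])
    then have AE: "AE Z in std_normal_matrix. \<phi> (?g Z) = \<phi> V"
      by (intro AE_std_normal_matrix) measurable
    have sets: "sets (std_normal_matrix :: (real^'p^'n) measure) = sets borel"
      by (simp add: std_normal_matrix_def)
    have meas: "?g \<in> std_normal_matrix \<rightarrow>\<^sub>M borel"
      using g_meas by (simp cong: measurable_cong_sets add: sets)
    have "test_power X \<phi> B \<Sigma> \<Psi> = (\<integral>Z. \<phi> (?g Z) \<partial>std_normal_matrix)"
      unfolding test_power_def matrix_normal_def using meas \<phi>_meas by (rule integral_distr)
    also have "\<dots> = (\<integral>Z. \<phi> V \<partial>(std_normal_matrix :: (real^'p^'n) measure))"
      using AE meas \<phi>_meas by (intro integral_cong_AE) (auto intro: measurable_compose)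
    also have "\<dots> = \<phi> V" by (simp add: N.prob_space)
    finally show ?thesis .
  qed
  \<comment> \<open>The level, read off at B = 0 with both covariances the identity, is itself one
    of the powers just computed.\<close>
  moreover have "\<alpha> = \<phi> V"
    if "randomized_test \<phi>" "invariant_under (transformations X) \<phi>" "has_level X \<alpha> \<phi>"
    for \<phi> :: "real^'p^'n \<Rightarrow> real" and \<alpha>
    using power[OF that(1,2) spd_mat_1 spd_mat_1, of 0] that(3) spd_mat_1 unfolding has_level_def by metis
  ultimately show ?thesis by blast
qed

end
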